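(* Let $F:\mathbb{R}^n\to\mathbb{R}\cup\{+\infty\}$ be an $\mathbb{R}$-DDM-convex function, and let $f:\mathbb{Z}^n\to\mathbb{R}\cup\{+\infty\}$ be the restriction of $F$ to $\mathbb{Z}^n$. If $\operatorname{dom} F$ is bounded, i.e. $\sup\{\|x-y\|_\infty\mid x,y\in\operatorname{dom} F\}<\infty$, then for each $\overline{x}\in\operatorname{argmin} F$ there exists $x^*\in\operatorname{argmin} f$ with $\|x^*-\overline{x}\|_\infty\le n$.
   Context: For $x,y\in\mathbb{Z}^n$, the vector $\mu(x,y)\in\mathbb{Z}^n$ is defined componentwise by $\mu(x,y)_i=\lceil (x_i+y_i)/2\rceil$ if $x_i\ge y_i$, and $\mu(x,y)_i=\lfloor (x_i+y_i)/2\rfloor$ if $x_i<y_i$. A function $f:\mathbb{Z}^n\to\mathbb{R}\cup\{+\infty\}$ is called DDM-convex if $f(x)+f(y)\ge f(\mu(x,y))+f(\mu(y,x))$ for all $x,y\in\mathbb{Z}^n$. A continuous convex function $F:\mathbb{R}^n\to\mathbb{R}\cup\{+\infty\}$ (continuous as a map from $\mathbb{R}^n$ into $\mathbb{R}\cup\{+\infty\}$ with its usual topology) is called an $\mathbb{R}$-DDM-convex function if for every positive integer $\alpha$ the function $f^{1/\alpha}:\mathbb{Z}^n\to\mathbb{R}\cup\{+\infty\}$ defined by $f^{1/\alpha}(x)=F(x/\alpha)$ $(x\in\mathbb{Z}^n)$ is DDM-convex. $\operatorname{dom} F=\{x\in\mathbb{R}^n\mid F(x)<+\infty\}$, $\operatorname{argmin}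 F=\{x\in\mathbb{R}^n\mid F(x)\le F(z)\ \forall z\in\mathbb{R}^n\}$, and $\operatorname{argmin} f=\{x\in\mathbb{Z}^n\mid f(x)\le f(z)\ \forall z\in\mathbb{Z}^n\}$. *)

theory Defs
  imports "HOL-Analysis.Analysis"
begin

definition mu :: "int ^ 'n \<Rightarrow> int ^ 'n \<Rightarrow> int ^ 'n" where
  "mu x y = (\<chi> i. if x $ i \<ge> y $ i
                   then \<lceil>(real_of_int (x $ i) + real_of_int (y $ i)) / 2\<rceil>
                   else \<lfloor>(real_of_int (x $ i) + real_of_int (y $ i)) / 2\<rfloor>)"

text \<open>Functions into \<open>\<real> \<union> {+\<infinity>}\<close> are rendered as \<open>ereal\<close>-valued functions that omit the value
  \<open>-\<infinity>\<close>; this range condition is part of the two convexity predicates below.\<close>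

definition ddm_convex :: "(int ^ 'n \<Rightarrow> ereal) \<Rightarrow> bool" where
  "ddm_convex f \<longleftrightarrow>
     (\<forall>x. f x \<noteq> -\<infinity>) \<and> (\<forall>x y. f x + f y \<ge> f (mu x y) + f (mu y x))"

text \<open>The library's \<open>convex_on\<close> only covers real-valued functions. At the endpoints \<open>t = 0\<close> and
  \<open>t = 1\<close> the \<open>ereal\<close> convention \<open>0 * \<infinity> = 0\<close> makes the inequality trivial.\<close>

definition ext_convex :: "('a::real_vector \<Rightarrow> ereal) \<Rightarrow> bool" where
  "ext_convex F \<longleftrightarrow>
     (\<forall>x y. \<forall>t\<in>{0..1::real}.
        F ((1 - t) *\<^sub>R x + t *\<^sub>R y) \<le> ereal (1 - t) * F x + ereal t * F y)"

definition real_vec :: "int ^ 'n \<Rightarrow> real ^ 'n" where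
  "real_vec x = (\<chi> i. real_of_int (x $ i))"

definition real_ddm_convex :: "(real ^ 'n \<Rightarrow> ereal) \<Rightarrow> bool" where
  "real_ddm_convex F \<longleftrightarrow>
     (\<forall>x. F x \<noteq> -\<infinity>) \<and> continuous_on UNIV F \<and> ext_convex F \<and>
     (\<forall>\<alpha>::nat. \<alpha> > 0 \<longrightarrow> ddm_convex (\<lambda>x. F (real_vec x /\<^sub>R real \<alpha>)))"

definition eff_dom :: "('a \<Rightarrow> ereal) \<Rightarrow> 'a set" where
  "eff_dom F = {x. F x < \<infinity>}"

definition argmin :: "('a \<Rightarrow> ereal) \<Rightarrow> 'a set" where
  "argmin F = {x. \<forall>z. F x \<le> F z}"

end

theory Submission
  imports Defs "HOL-Real_Asymp.Real_Asymp"
begin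

text \<open>
  The proof is an exchange argument between the real minimiser \<open>x\<close> and a minimiser \<open>y\<close> of the
  restriction to the integer lattice that is closest to \<open>x\<close> in the \<open>\<ell>\<^sub>1\<close> distance. Such a \<open>y\<close>
  exists because the bounded effective domain contains only finitely many lattice points. (If it
  contains none, every lattice point is a minimiser and rounding \<open>x\<close> suffices.) Suppose that some
  \<open>\<bar>y\<^sub>i - x\<^sub>i\<bar>\<close> exceeds \<open>n\<close>. The at most \<open>n\<close> distinct values \<open>\<bar>y\<^sub>j - x\<^sub>j\<bar>\<close> then leave a gap: for some
  \<open>a\<close> below \<open>\<bar>y\<^sub>i - x\<^sub>i\<bar>\<close>, each value is at most \<open>a\<close> or more than \<open>a + 1\<close> (\<open>exists_unit_gap\<close>). Let \<open>d\<close> be the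
  \<open>{-1, 0, 1}\<close>-vector that carries the signs of \<open>y - x\<close> on the coordinates above the gap. The heart
  of the matter is
  \<open>F (x + d) + F (y - d) \<le> F x + F y\<close>; as \<open>F x\<close> is minimal this gives \<open>F (y - d) \<le> F y\<close>, so that
  \<open>y - d\<close> is again a lattice minimiser, strictly closer to \<open>x\<close>: a contradiction.

  The inequality is obtained on the grids of mesh \<open>1/k\<close>, with \<open>x\<close> rounded to the grid and
  \<open>k \<rightarrow> \<infinity>\<close> (\<open>exchange_across_gap\<close>). On a grid it is an instance of a parallelogram inequality for
  DDM-convex \<open>f\<close> (\<open>ddm_convex_parallelogram\<close>): cut \<open>v\<close> into layers, where layer \<open>j\<close> is the
  \<open>{-1, 0, 1}\<close>-vector of the signs of those \<open>v\<^sub>i\<close> with \<open>\<bar>v\<^sub>i\<bar> > j\<close>; then any set of layers can be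
  moved from the end \<open>x + v\<close> to the start \<open>x\<close>. In other words \<open>g J = f (x + \<Sum>\<^bsub>j\<in>J\<^esub> layer j)\<close>
  is a supermodular set function. The definition of \<open>mu\<close> says this for one particular way of
  splitting each interval of sets, because halving with rounding towards \<open>0\<close> picks every second
  layer; and a set function with values in \<open>\<real> \<union> {+\<infinity>}\<close> that satisfies the inequality for one
  proper splitting of each interval is supermodular (\<open>supermodular_of_split\<close>).
\<close>

section \<open>Supermodularity from one splitting of each interval\<close>

text \<open>
  This is what makes the value \<open>+\<infinity>\<close> harmless: a telescoping proof of supermodularity cancels
  values at intermediate sets, which must therefore be known to be finite. If \<open>D\<close> splits into \<open>L\<close>
  and \<open>D - L\<close>, induction on the intervals from \<open>I\<close> to \<open>I \<union> L\<close> and from \<open>I \<union> L\<close> to \<open>I \<union> D\<close> reaches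
  \<open>J \<inter> L\<close> and \<open>J \<union> L\<close>. The set \<open>J\<close> lies between these two, and their difference is smaller than \<open>D\<close>
  except when \<open>J = D - L\<close>, where the splitting inequality already gives the claim.
\<close>

lemma finite_between_of_split:
  fixes g :: "'a set \<Rightarrow> ereal"
  assumes bounded_below: "\<And>J. g J \<noteq> -\<infinity>"
    and split: "\<And>I D. finite D \<Longrightarrow> I \<inter> D = {} \<Longrightarrow> 2 \<le> card D \<Longrightarrow>
      \<exists>L. L \<subset> D \<and> L \<noteq> {} \<and> g (I \<union> L) + g (I \<union> (D - L)) \<le> g I + g (I \<union> D)"
  shows "finite D \<Longrightarrow> I \<inter> D = {} \<Longrightarrow> J \<subseteq> D \<Longrightarrow> g I \<noteq> \<infinity> \<Longrightarrow> g (I \<union> D) \<noteq> \<infinity>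
    \<Longrightarrow> g (I \<union> J) \<noteq> \<infinity>"
proof (induction "card D" arbitrary: D I J rule: less_induct)
  case less
  show ?case
  proof (cases "2 \<le> card D")
    case False
    then have "card D = 0 \<or> card D = 1" by linarith
    then have "J = {} \<or> J = D"
      using less.prems(1,3) by (auto simp: card_1_singleton_iff)
    then show ?thesis using less.prems by auto
  next
    case True
    then obtain L where L: "L \<subset> D" "L \<noteq> {}"
        "g (I \<union> L) + g (I \<union> (D - L)) \<le> g I + g (I \<union> D)"
      using split[OF less.prems(1,2) True] by blast
    have fin: "g (I \<union> L) \<noteq> \<infinity>" "g (I \<union> (D - L)) \<noteq> \<infinity>"
      using L(3) less.prems(4,5) bounded_below by (auto simp: ereal_plus_eq_PInfty)
    show ?thesis
    proof (cases "J = D - L")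
      case True
      then show ?thesis using fin by simp
    next
      case False
      have "g (I \<union> (J \<inter> L)) \<noteq> \<infinity>"
      proof (rule less.hyps[of L])
        show "card L < card D" "finite L"
          using L(1) less.prems(1) by (auto intro: psubset_card_mono finite_subset)
      qed (use L(1) less.prems fin in auto)
      moreover have "g ((I \<union> L) \<union> (J - L)) \<noteq> \<infinity>"
      proof (rule less.hyps[of "D - L"])
        show "card (D - L) < card D"
          using L less.prems(1) by (intro psubset_card_mono) auto
        show "g (I \<union> L \<union> (D - L)) \<noteq> \<infinity>"
          using less.prems(5) L(1) by (simp add: Un_assoc Un_absorb1 psubset_imp_subset)
      qed (use L less.prems fin in auto)
      moreover have "I \<union> L \<union> (J - L) = (I \<union> (J \<inter> L)) \<union> ((L - J) \<union> (J - L))"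
        by auto
      ultimately have ends: "g (I \<union> (J \<inter> L)) \<noteq> \<infinity>"
          "g ((I \<union> (J \<inter> L)) \<union> ((L - J) \<union> (J - L))) \<noteq> \<infinity>"
        by simp_all
      have "g ((I \<union> (J \<inter> L)) \<union> (J - L)) \<noteq> \<infinity>"
      proof (rule less.hyps[of "(L - J) \<union> (J - L)"])
        have sub: "(L - J) \<union> (J - L) \<subset> D"
          using L(1) less.prems(3) False by blast
        then show "card ((L - J) \<union> (J - L)) < card D"
          using less.prems(1) by (rule psubset_card_mono[rotated])
        show "finite ((L - J) \<union> (J - L))"
          using sub less.prems(1) by (meson finite_subset psubset_imp_subset)
        show "(I \<union> (J \<inter> L)) \<inter> ((L - J) \<union> (J - L)) = {}"
          using L(1) less.prems(2,3) by blast
      qed (use ends in auto)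
      moreover have "(I \<union> (J \<inter> L)) \<union> (J - L) = I \<union> J" by auto
      ultimately show ?thesis by simp
    qed
  qed
qed

text \<open>
  For two singletons the proper splitting is unique and the claim is the hypothesis itself. Larger
  rectangles of sets are tiled by smaller ones: peeling one point \<open>a\<close> off \<open>A\<close> leaves two inequalities
  that add up to the claim after cancelling the values at \<open>I \<union> (A - {a})\<close> and
  \<open>I \<union> (A - {a}) \<union> B\<close>.
\<close>

lemma supermodular_of_split:
  fixes g :: "'a set \<Rightarrow> ereal"
  assumes bounded_below: "\<And>J. g J \<noteq> -\<infinity>"
    and split: "\<And>I D. finite D \<Longrightarrow> I \<inter> D = {} \<Longrightarrow> 2 \<le> card D \<Longrightarrow>
      \<exists>L. L \<subset> D \<and> L \<noteq> {} \<and> g (I \<union> L) + g (I \<union> (D - L)) \<le> g I + g (I \<union> D)"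
  shows "finite A \<Longrightarrow> finite B \<Longrightarrow> A \<inter> B = {} \<Longrightarrow> I \<inter> (A \<union> B) = {} \<Longrightarrow>
    g (I \<union> A) + g (I \<union> B) \<le> g I + g (I \<union> (A \<union> B))"
proof (induction "card (A \<union> B)" arbitrary: A B I rule: less_induct)
  case less
  have peel: "g (I \<union> A) + g (I \<union> B) \<le> g I + g (I \<union> (A \<union> B))"
    if two: "2 \<le> card A" and AB: "finite A" "finite B" "A \<inter> B = {}" "I \<inter> (A \<union> B) = {}"
      "card (A \<union> B) = n" and B: "B \<noteq> {}"
      and IH: "\<And>A B I. card (A \<union> B) < n \<Longrightarrow> finite A \<Longrightarrow> finite B \<Longrightarrow> A \<inter> B = {} \<Longrightarrow>
        I \<inter> (A \<union> B) = {} \<Longrightarrow> g (I \<union> A) + g (I \<union> B) \<le> g I + g (I \<union> (A \<union> B))"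
    for A B I n
  proof (cases "g I = \<infinity> \<or> g (I \<union> (A \<union> B)) = \<infinity>")
    case True
    then show ?thesis using bounded_below by auto
  next
    case False
    from two obtain a where a: "a \<in> A" by fastforce
    define A' where "A' = A - {a}"
    have A': "A = A' \<union> {a}" "a \<notin> A'" using a by (auto simp: A'_def)
    have ne: "A' \<noteq> {}"
    proof
      assume "A' = {}"
      then have "A = {a}" using A'(1) by simp
      then show False using two by simp
    qed
    have fin: "g J \<noteq> \<infinity>" if "I \<subseteq> J" "J \<subseteq> I \<union> (A \<union> B)" for J
    proof -
      have "g (I \<union> (J - I)) \<noteq> \<infinity>"
      proof (rule finite_between_of_split[where D = "A \<union> B"])
        show "\<exists>L. L \<subset> D \<and> L \<noteq> {} \<and> g (I \<union> L) + g (I \<union> (D - L)) \<le> g I + g (I \<union> D)"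
          if "finite D" "I \<inter> D = {}" "2 \<le> card D" for I D
          using that by (rule split)
      qed (use False AB that bounded_below in auto)
      then show ?thesis using that by (simp add: Un_absorb1)
    qed
    have "g (I \<union> A') + g (I \<union> B) \<le> g I + g (I \<union> (A' \<union> B))"
    proof (rule IH)
      have "A' \<union> B \<subset> A \<union> B" using A' AB by auto
      then show "card (A' \<union> B) < n" using AB by (metis finite_Un psubset_card_mono)
    qed (use AB A' in auto)
    moreover have "g ((I \<union> A') \<union> {a}) + g ((I \<union> A') \<union> B)
        \<le> g (I \<union> A') + g ((I \<union> A') \<union> ({a} \<union> B))"
    proof (rule IH)
      have "{a} \<union> B \<subset> A \<union> B" using A' AB ne by auto
      then show "card ({a} \<union> B) < n" using AB by (metis finite_Un psubset_card_mono)
    qed (use AB A' in auto)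
    moreover have "(I \<union> A') \<union> {a} = I \<union> A" "(I \<union> A') \<union> ({a} \<union> B) = I \<union> (A \<union> B)"
        "I \<union> (A' \<union> B) = (I \<union> A') \<union> B"
      using A' by auto
    moreover obtain p where "g I = ereal p"
      using fin[of I] bounded_below[of I] by (cases "g I") auto
    moreover obtain q where "g (I \<union> A') = ereal q"
      using fin[of "I \<union> A'"] A' bounded_below[of "I \<union> A'"] by (cases "g (I \<union> A')") auto
    moreover have "g (I \<union> A' \<union> B) \<noteq> \<infinity>" using A' by (intro fin) auto
    then obtain r where "g (I \<union> A' \<union> B) = ereal r"
      using bounded_below[of "I \<union> A' \<union> B"] by (cases "g (I \<union> A' \<union> B)") auto
    moreover have "g (I \<union> A) \<noteq> \<infinity>" "g (I \<union> B) \<noteq> \<infinity>" by (rule fin; blast)+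
    moreover obtain s where "g (I \<union> (A \<union> B)) = ereal s"
      using False bounded_below[of "I \<union> (A \<union> B)"] by (cases "g (I \<union> (A \<union> B))") auto
    ultimately show ?thesis
      using bounded_below[of "I \<union> A"] bounded_below[of "I \<union> B"]
      by (cases "g (I \<union> A)"; cases "g (I \<union> B)") auto
  qed
  consider "A = {}" | "B = {}" | "A \<noteq> {}" "2 \<le> card B" | "B \<noteq> {}" "2 \<le> card A"
    | "card A = 1" "card B = 1"
    using less.prems(1,2) by (metis One_nat_def Suc_leI card_gt_0_iff le_antisym not_less_eq_eq numeral_2_eq_2)
  then show ?case
  proof cases
    case 3
    have "g (I \<union> B) + g (I \<union> A) \<le> g I + g (I \<union> (B \<union> A))"
    proof (rule peel[where n = "card (B \<union> A)"])
      show "g (I' \<union> A') + g (I' \<union> B') \<le> g I' + g (I' \<union> (A' \<union> B'))"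
        if "card (A' \<union> B') < card (B \<union> A)" "finite A'" "finite B'" "A' \<inter> B' = {}"
          "I' \<inter> (A' \<union> B') = {}" for A' B' I'
        using that by (intro less.hyps) (simp_all add: Un_commute)
    qed (use 3 less.prems in \<open>simp_all add: Un_commute Int_commute\<close>)
    then show ?thesis by (simp add: add.commute Un_commute)
  next
    case 4
    show ?thesis
    proof (rule peel[where n = "card (A \<union> B)"])
      show "g (I' \<union> A') + g (I' \<union> B') \<le> g I' + g (I' \<union> (A' \<union> B'))"
        if "card (A' \<union> B') < card (A \<union> B)" "finite A'" "finite B'" "A' \<inter> B' = {}"
          "I' \<inter> (A' \<union> B') = {}" for A' B' I'
        using that by (intro less.hyps) (simp_all add: Un_commute)
    qed (use 4 less.prems in \<open>simp_all add: Un_commute Int_commute\<close>)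
  next
    case 5
    then obtain a b where ab: "A = {a}" "B = {b}" by (auto simp: card_1_singleton_iff)
    have "a \<noteq> b" using ab less.prems by auto
    then have "2 \<le> card (A \<union> B)" using ab by auto
    then obtain L where L: "L \<subset> A \<union> B" "L \<noteq> {}"
        "g (I \<union> L) + g (I \<union> (A \<union> B - L)) \<le> g I + g (I \<union> (A \<union> B))"
      using split[of "A \<union> B" I] less.prems by auto
    then have "L = A \<or> L = B" using ab by auto
    then show ?thesis
    proof
      assume "L = A"
      moreover have "A \<union> B - A = B" using less.prems by auto
      ultimately show ?thesis using L(3) by simp
    next
      assume "L = B"
      moreover have "A \<union> B - B = A" using less.prems by auto
      ultimately show ?thesis using L(3) by (simp add: add.commute)
    qed
  qed (auto simp: add.commute)
qed

section \<open>The parallelogram inequality for DDM-convex functions\<close>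

text \<open>
  The sum of the layers of \<open>v\<close> with index in \<open>J\<close>, where layer \<open>k\<close> has the entry \<open>sgn (v $ i)\<close> if
  \<open>k < \<bar>v $ i\<bar>\<close> and \<open>0\<close> otherwise. Counting the layers instead of adding them turns the arithmetic of
  \<open>mu\<close> into a statement about cardinalities.
\<close>

definition layers :: "int ^ 'n \<Rightarrow> nat set \<Rightarrow> int ^ 'n" where
  "layers v J = (\<chi> i. sgn (v $ i) * int (card (J \<inter> {..<nat \<bar>v $ i\<bar>})))"

lemma layers_Un: "J \<inter> K = {} \<Longrightarrow> layers v (J \<union> K) = layers v J + layers v K"
proof -
  assume "J \<inter> K = {}"
  then have "card ((J \<union> K) \<inter> {..<n}) = card (J \<inter> {..<n}) + card (K \<inter> {..<n})" for n
    unfolding Int_Un_distrib2 by (intro card_Un_disjoint) auto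
  then show ?thesis by (simp add: layers_def vec_eq_iff algebra_simps)
qed

lemma layers_empty [simp]: "layers v {} = 0"
  by (simp add: layers_def vec_eq_iff)

lemma layers_all:
  assumes "\<And>i. nat \<bar>v $ i\<bar> \<le> m"
  shows "layers v {..<m} = v"
proof -
  have "{..<m} \<inter> {..<nat \<bar>v $ i\<bar>} = {..<nat \<bar>v $ i\<bar>}" for i
    using assms[of i] by auto
  then show ?thesis by (simp add: layers_def vec_eq_iff mult_sgn_abs)
qed

text \<open>
  Every second element of \<open>D\<close>: the elements \<open>k\<close> whose rank, counted from \<open>1\<close>, is even. Starting with
  the second element rather than the first matches the rounding of halves towards \<open>0\<close>.
\<close>

definition even_ranked :: "nat set \<Rightarrow> nat set" where
  "even_ranked D = {k \<in> D. even (card (D \<inter> {..k}))}"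

lemma card_even_ranked: "card (even_ranked D \<inter> {..<n}) = card (D \<inter> {..<n}) div 2"
proof (induction n)
  case (Suc n)
  have *: "S \<inter> {..<Suc n} = (if n \<in> S then insert n (S \<inter> {..<n}) else S \<inter> {..<n})" for S
    by (auto simp: less_Suc_eq)
  have "card (D \<inter> {..n}) = Suc (card (D \<inter> {..<n}))" if "n \<in> D"
    using that *[of D] by (simp add: lessThan_Suc_atMost)
  then have "n \<in> even_ranked D \<longleftrightarrow> n \<in> D \<and> odd (card (D \<inter> {..<n}))"
    by (auto simp: even_ranked_def)
  then show ?case using Suc by (auto simp: *)
qed (simp add: even_ranked_def)

text \<open>
  In both argument orders the rounding rule moves each argument towards the other by half of the
  difference, rounded towards \<open>0\<close>.
\<close>

lemma mu_eq_halve: "mu x (x + v) = x + (\<chi> i. sgn (v $ i) * (\<bar>v $ i\<bar> div 2))"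
  and mu_eq_halve': "mu (x + v) x = x + v - (\<chi> i. sgn (v $ i) * (\<bar>v $ i\<bar> div 2))"
proof -
  have fl: "\<lfloor>real_of_int a / 2\<rfloor> = a div 2" for a :: int
    by (metis floor_divide_of_int_eq of_int_numeral)
  have ce: "\<lceil>real_of_int a / 2\<rceil> = - ((- a) div 2)" for a :: int
    by (metis ceiling_def fl minus_divide_left of_int_minus)
  have s: "real_of_int a + real_of_int b = real_of_int (a + b)" for a b :: int by simp
  show "mu x (x + v) = x + (\<chi> i. sgn (v $ i) * (\<bar>v $ i\<bar> div 2))"
    unfolding mu_def s fl ce by (auto simp: vec_eq_iff sgn_if abs_if)
  show "mu (x + v) x = x + v - (\<chi> i. sgn (v $ i) * (\<bar>v $ i\<bar> div 2))"
    unfolding mu_def s fl ce by (auto simp: vec_eq_iff sgn_if abs_if)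
qed

text \<open>
  Halving acts uniformly on all coordinates although these see different initial segments of \<open>D\<close>:
  \<open>even_ranked D\<close> contains half of every initial segment.
\<close>

lemma halve_layers:
  "(\<chi> i. sgn (layers v D $ i) * (\<bar>layers v D $ i\<bar> div 2)) = layers v (even_ranked D)"
proof -
  have "sgn (s * int c) * (\<bar>s * int c\<bar> div 2) = s * int (c div 2)"
    if "s \<in> {-1, 0, 1}" for s c
    using that by (cases "c = 0") (auto simp: zdiv_int)
  moreover have "sgn (v $ i) \<in> {-1, 0, 1}" for i by (auto simp: sgn_if)
  ultimately show ?thesis
    by (simp add: layers_def vec_eq_iff card_even_ranked)
qed

text \<open>
  For \<open>P = x + layers v I\<close> and \<open>Q = x + layers v (I \<union> D)\<close>, the points \<open>mu P Q\<close> and \<open>mu Q P\<close> arise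
  from \<open>P\<close> by adding the even-ranked and the odd-ranked layers of \<open>D\<close>. Hence DDM-convexity is the
  splitting hypothesis of \<open>supermodular_of_split\<close>.
\<close>

lemma ddm_convex_parallelogram:
  fixes f :: "int ^ 'n \<Rightarrow> ereal"
  assumes f: "ddm_convex f"
  shows "f (x + layers v J) + f (x + v - layers v J) \<le> f x + f (x + v)"
proof -
  define g where "g J = f (x + layers v J)" for J
  have nm: "g J \<noteq> -\<infinity>" for J using f by (simp add: g_def ddm_convex_def)
  have split: "\<exists>L. L \<subset> D \<and> L \<noteq> {} \<and> g (I \<union> L) + g (I \<union> (D - L)) \<le> g I + g (I \<union> D)"
    if D: "finite D" "I \<inter> D = {}" "2 \<le> card D" for I D
  proof -
    let ?L = "even_ranked D"
    have sub: "?L \<subseteq> D" by (auto simp: even_ranked_def)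
    obtain n where n: "D \<subseteq> {..<n}" using D(1) by (metis finite_nat_iff_bounded)
    have "card ?L = card D div 2"
      using card_even_ranked[of D n] n sub by (simp add: Int_absorb2 subset_trans)
    then have "?L \<noteq> {}" "?L \<noteq> D" using D(3) by auto
    moreover have "g (I \<union> ?L) + g (I \<union> (D - ?L)) \<le> g I + g (I \<union> D)"
    proof -
      define P where "P = x + layers v I"
      have "layers v D = layers v ?L + layers v (D - ?L)"
        using layers_Un[of ?L "D - ?L" v] sub by (simp add: Un_absorb1)
      moreover have "g (I \<union> ?L) = f (P + layers v ?L)" "g (I \<union> D) = f (P + layers v D)"
          "g (I \<union> (D - ?L)) = f (P + layers v (D - ?L))"
        using D(2) sub unfolding g_def P_def by (subst layers_Un; auto simp: add.assoc)+
      moreover have "f (mu P (P + layers v D)) + f (mu (P + layers v D) P)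
          \<le> f P + f (P + layers v D)"
        using f by (simp add: ddm_convex_def)
      ultimately show ?thesis
        unfolding mu_eq_halve mu_eq_halve' halve_layers by (simp add: P_def g_def algebra_simps)
    qed
    ultimately show ?thesis using sub by blast
  qed
  obtain m where m: "\<And>i. nat \<bar>v $ i\<bar> \<le> m"
    using that[of "Max (range (\<lambda>i. nat \<bar>v $ i\<bar>))"] by simp
  \<comment> \<open>Layers with index at least \<open>m\<close> vanish, so \<open>J\<close> may be cut down to a finite set.\<close>
  let ?A = "J \<inter> {..<m}" and ?B = "{..<m} - J"
  have J: "layers v J = layers v ?A"
  proof -
    have "J \<inter> {..<nat \<bar>v $ i\<bar>} = ?A \<inter> {..<nat \<bar>v $ i\<bar>}" for i
      using m[of i] by auto
    then show ?thesis by (simp add: layers_def)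
  qed
  have "v = layers v (?A \<union> ?B)"
    using layers_all[of v m] m by (metis Int_commute Int_Diff_Un)
  then have AB: "v = layers v ?A + layers v ?B"
    by (subst (asm) layers_Un) auto
  have "g ({} \<union> ?A) + g ({} \<union> ?B) \<le> g {} + g ({} \<union> (?A \<union> ?B))"
    by (rule supermodular_of_split) (use nm split in auto)
  moreover have "g ({} \<union> (?A \<union> ?B)) = f (x + v)"
    using \<open>v = layers v (?A \<union> ?B)\<close> by (simp add: g_def)
  moreover have "g ({} \<union> ?B) = f (x + v - layers v J)"
    using AB J by (simp add: g_def) (metis add_diff_cancel_left' add_diff_eq)
  ultimately show ?thesis using J by (simp add: g_def)
qed

section \<open>Moving a lattice point across a gap\<close>

text \<open>
  Without a gap, each interval \<open>(j - 1, j]\<close> with \<open>1 \<le> j \<le> card S\<close> contains a point of \<open>S\<close>. Together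
  with \<open>M\<close>, which lies beyond all of these intervals, that is one point too many.
\<close>

lemma exists_unit_gap:
  fixes S :: "real set"
  assumes S: "finite S" "M \<in> S" and M: "real (card S) < M"
  shows "\<exists>a. 0 \<le> a \<and> a < M \<and> (\<forall>s\<in>S. s \<le> a \<or> a + 1 < s)"
proof (rule ccontr)
  assume no_gap: "\<not> ?thesis"
  have "int j \<in> ceiling ` S" if j: "j \<in> {1..card S}" for j
  proof -
    have "0 \<le> real j - 1" "real j - 1 < M" using j M by auto
    then obtain s where s: "s \<in> S" "\<not> (s \<le> real j - 1 \<or> real j - 1 + 1 < s)"
      using no_gap by blast
    then have "\<lceil>s\<rceil> = int j" by (intro ceiling_unique) auto
    then show ?thesis using s(1) by (metis imageI)
  qed
  then have "int ` {1..card S} \<subseteq> ceiling ` S" by blast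
  moreover have "\<lceil>M\<rceil> \<notin> int ` {1..card S}"
    using M by (auto simp: ceiling_eq_iff)
  ultimately have "card (insert \<lceil>M\<rceil> (int ` {1..card S})) \<le> card (ceiling ` S)"
    using S by (intro card_mono) auto
  also have "\<dots> \<le> card S" using S(1) by (rule card_image_le)
  finally show False
    using \<open>\<lceil>M\<rceil> \<notin> int ` {1..card S}\<close> by (simp add: card_image)
qed

text \<open>
  On the grid of mesh \<open>1/k\<close> the gap has length more than \<open>k\<close>, so \<open>k\<close> consecutive layers of the
  difference fit into it even after rounding \<open>x\<close>. These layers are all equal to the sign vector \<open>d\<close>,
  and \<open>k\<close> grid steps along \<open>d\<close> are one step of the integer lattice. The parallelogram inequality
  with the minimality of \<open>F x\<close> then bounds \<open>F x + F (y - d)\<close> by the values at the rounding of \<open>x\<close> and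
  at \<open>y\<close>, and continuity of \<open>F\<close> at \<open>x\<close> yields the claim as \<open>k \<rightarrow> \<infinity>\<close>.
\<close>

lemma exchange_across_gap:
  fixes F :: "real ^ 'n \<Rightarrow> ereal" and y :: "int ^ 'n"
  defines "w \<equiv> \<lambda>x i. real_of_int (y $ i) - x $ i"
  defines "d \<equiv> \<lambda>x a. \<chi> i. if \<bar>w x i\<bar> \<le> a then 0 else if 0 < w x i then 1 else -1"
  assumes F: "real_ddm_convex F" and x: "x \<in> argmin F" "F x \<noteq> \<infinity>"
    and y: "F (real_vec y) \<noteq> \<infinity>"
    and a: "0 \<le> a" and gap: "\<And>i. \<bar>w x i\<bar> \<le> a \<or> a + 1 < \<bar>w x i\<bar>"
  shows "F (real_vec (y - d x a)) \<le> F (real_vec y)"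
proof -
  define e where "e = d x a"
  \<comment> \<open>Finitely many coordinates clear the gap strictly, hence by a common margin, which absorbs rounding.\<close>
  obtain \<epsilon> where \<epsilon>: "0 < \<epsilon>" "\<And>i. \<bar>w x i\<bar> \<le> a \<or> a + 1 + \<epsilon> \<le> \<bar>w x i\<bar>"
  proof
    let ?E = "insert 1 ((\<lambda>i. \<bar>w x i\<bar> - a - 1) ` {i. a < \<bar>w x i\<bar>})"
    have "0 < \<bar>w x i\<bar> - a - 1" if "a < \<bar>w x i\<bar>" for i
      using gap[of i] that by linarith
    then show "0 < Min ?E" by (subst Min_gr_iff) auto
    show "\<bar>w x i\<bar> \<le> a \<or> a + 1 + Min ?E \<le> \<bar>w x i\<bar>" for i
    proof (cases "\<bar>w x i\<bar> \<le> a")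
      case False
      then have "Min ?E \<le> \<bar>w x i\<bar> - a - 1" by (intro Min_le) auto
      then show ?thesis by simp
    qed simp
  qed
  define X where "X k = (\<chi> i. \<lfloor>real k * x $ i\<rfloor>)" for k :: nat
  have "(\<lambda>k. real_of_int \<lfloor>real k * c\<rfloor> / real k) \<longlonglongrightarrow> c" for c :: real
    by real_asymp
  then have "(\<lambda>k. real_vec (X k) /\<^sub>R real k) \<longlonglongrightarrow> x"
    by (intro vec_tendstoI) (simp add: real_vec_def X_def divide_inverse_commute)
  moreover have "isCont F x"
    using F by (auto simp: real_ddm_convex_def continuous_on_eq_continuous_at)
  ultimately have "(\<lambda>k. F (real_vec (X k) /\<^sub>R real k)) \<longlonglongrightarrow> F x"
    by (rule isCont_tendsto_compose[rotated])
  moreover have notm: "F z \<noteq> -\<infinity>" for z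
    using F by (simp add: real_ddm_convex_def)
  ultimately have lim: "(\<lambda>k. F (real_vec (X k) /\<^sub>R real k) + F (real_vec y))
      \<longlonglongrightarrow> F x + F (real_vec y)"
    using x y by (intro tendsto_add_ereal_general tendsto_const) auto
  have step: "F x + F (real_vec (y - e)) \<le> F (real_vec (X k) /\<^sub>R real k) + F (real_vec y)"
    if k: "0 < k" "3 \<le> real k * \<epsilon>" for k
  proof -
    define v where "v = (\<chi> i. int k * y $ i - X k $ i)"
    define b where "b = nat \<lceil>real k * a\<rceil> + 1"
    \<comment> \<open>Rounding \<open>x\<close> moves each \<open>v $ i\<close> by less than \<open>1\<close> and rounding \<open>b\<close> costs less than \<open>2\<close>:
      the margin \<open>k * \<epsilon> \<ge> 3\<close> covers both.\<close>
    have b: "real k * a + 1 \<le> real b" "real b < real k * a + 2"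
      using a by (simp_all add: b_def) linarith+
    have v: "real k * w x i \<le> real_of_int (v $ i)" "real_of_int (v $ i) < real k * w x i + 1" for i
      by (simp_all add: v_def X_def w_def algebra_simps) linarith+
    have "layers v {b..<b + k} $ i = int k * e $ i" for i
    proof (cases "\<bar>w x i\<bar> \<le> a")
      case True
      have "\<bar>real k * w x i\<bar> \<le> real k * a"
        using True by (simp add: abs_mult mult_left_mono)
      then have "\<bar>real_of_int (v $ i)\<bar> \<le> real b" using v[of i] b by linarith
      then have "nat \<bar>v $ i\<bar> \<le> b" by linarith
      then have "{b..<b + k} \<inter> {..<nat \<bar>v $ i\<bar>} = {}" by auto
      then show ?thesis using True by (simp add: layers_def e_def d_def)
    next
      case False
      then have "real k * (a + 1 + \<epsilon>) \<le> real k * \<bar>w x i\<bar>"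
        using \<epsilon>(2)[of i] by (intro mult_left_mono) auto
      then have big: "real b + real k + 1 \<le> \<bar>real k * w x i\<bar>"
        using b k by (simp add: abs_mult algebra_simps)
      then have "real b + real k \<le> \<bar>real_of_int (v $ i)\<bar>" using v[of i] by linarith
      then have "b + k \<le> nat \<bar>v $ i\<bar>" by linarith
      then have "{b..<b + k} \<inter> {..<nat \<bar>v $ i\<bar>} = {b..<b + k}" by auto
      moreover have "sgn (v $ i) = e $ i"
      proof (cases "0 < w x i")
        case True
        then have "0 < real k * w x i" using k by simp
        then have "0 < real_of_int (v $ i)" using v[of i] by linarith
        then show ?thesis using True False by (simp add: e_def d_def)
      next
        case neg: False
        then have "real k * w x i \<le> 0" by (simp add: mult_nonneg_nonpos)
        then have "real_of_int (v $ i) < 0" using v[of i] big by linarith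
        then show ?thesis using neg False by (simp add: e_def d_def)
      qed
      ultimately show ?thesis by (simp add: layers_def)
    qed
    then have lay: "layers v {b..<b + k} = (\<chi> i. int k * e $ i)" by (simp add: vec_eq_iff)
    have y_eq: "real_vec (X k + v) /\<^sub>R real k = real_vec y"
      using k by (simp add: vec_eq_iff real_vec_def v_def)
    have ye_eq: "real_vec (X k + v - layers v {b..<b + k}) /\<^sub>R real k = real_vec (y - e)"
      using k unfolding lay by (simp add: vec_eq_iff real_vec_def v_def field_simps)
    have "ddm_convex (\<lambda>z. F (real_vec z /\<^sub>R real k))"
      using F k by (simp add: real_ddm_convex_def)
    from ddm_convex_parallelogram[OF this, of "X k" v "{b..<b + k}"]
    have "F (real_vec (X k + layers v {b..<b + k}) /\<^sub>R real k) + F (real_vec (y - e))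
        \<le> F (real_vec (X k) /\<^sub>R real k) + F (real_vec y)"
      by (simp only: y_eq ye_eq)
    moreover have "F x \<le> F (real_vec (X k + layers v {b..<b + k}) /\<^sub>R real k)"
      using x(1) by (simp add: argmin_def)
    ultimately show ?thesis by (meson add_right_mono order_trans)
  qed
  have "eventually (\<lambda>k. 0 < k \<and> 3 \<le> real k * \<epsilon>) sequentially"
  proof (rule eventually_sequentiallyI)
    fix k :: nat
    assume "nat \<lceil>3 / \<epsilon>\<rceil> + 1 \<le> k"
    then have "0 < k" "3 / \<epsilon> \<le> real k" by linarith+
    then show "0 < k \<and> 3 \<le> real k * \<epsilon>"
      using \<epsilon>(1) by (simp add: pos_divide_le_eq)
  qed
  then have "eventually (\<lambda>k. F x + F (real_vec (y - e))
      \<le> F (real_vec (X k) /\<^sub>R real k) + F (real_vec y)) sequentially"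
    by eventually_elim (use step in blast)
  with lim have "F x + F (real_vec (y - e)) \<le> F x + F (real_vec y)"
    by (intro tendsto_lowerbound) auto
  then show ?thesis
    using x(2) notm[of x] by (simp add: e_def ereal_add_le_add_iff)
qed

section \<open>Proximity of lattice minimisers\<close>

lemma finite_int_vectors_bounded: "finite {z :: int ^ 'n. \<forall>i. \<bar>z $ i\<bar> \<le> B i}"
proof (rule finite_subset)
  show "finite (vec_lambda ` (\<Pi>\<^sub>E i\<in>UNIV. {- B i..B i}) :: (int ^ 'n) set)"
    by (intro finite_imageI finite_PiE) auto
  show "{z. \<forall>i. \<bar>z $ i\<bar> \<le> B i} \<subseteq> vec_lambda ` (\<Pi>\<^sub>E i\<in>UNIV. {- B i..B i})"
  proof
    fix z :: "int ^ 'n"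
    assume "z \<in> {z. \<forall>i. \<bar>z $ i\<bar> \<le> B i}"
    then have "- B i \<le> z $ i \<and> z $ i \<le> B i" for i
      by (simp add: abs_le_iff) (metis minus_le_iff)
    then show "z \<in> vec_lambda ` (\<Pi>\<^sub>E i\<in>UNIV. {- B i..B i})"
      by (intro image_eqI[of _ _ "\<lambda>i. z $ i"]) auto
  qed
qed

lemma infnorm_le_cart: "(\<And>i. \<bar>x $ i\<bar> \<le> c) \<Longrightarrow> infnorm (x :: real ^ 'n) \<le> c"
  unfolding infnorm_cart by (rule cSup_least) auto

theorem theorem9p3:
  fixes F :: "real ^ 'n \<Rightarrow> ereal"
    and f :: "int ^ 'n \<Rightarrow> ereal"
    and xbar :: "real ^ 'n"
  assumes "real_ddm_convex F"
    and "\<And>x. f x = F (real_vec x)"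
    and "(SUP (x, y) \<in> eff_dom F \<times> eff_dom F. ereal (infnorm (x - y))) < \<infinity>"
    and "xbar \<in> argmin F"
  shows "\<exists>xstar \<in> argmin f. infnorm (real_vec xstar - xbar) \<le> real CARD('n)"
proof (cases "\<exists>z. f z \<noteq> \<infinity>")
  case False
  let ?z = "(\<chi> i. \<lfloor>xbar $ i\<rfloor>) :: int ^ 'n"
  have "infnorm (real_vec ?z - xbar) \<le> 1"
  proof (rule infnorm_le_cart)
    fix i
    show "\<bar>(real_vec ?z - xbar) $ i\<bar> \<le> 1"
      by (simp add: real_vec_def) linarith
  qed
  also have "1 \<le> real CARD('n)" by (simp add: Suc_le_eq)
  finally show ?thesis using False by (intro bexI[of _ ?z]) (auto simp: argmin_def)
next
  case True
  then obtain z0 where z0: "f z0 \<noteq> \<infinity>" by blast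
  define D where "D = {z. f z \<noteq> \<infinity>}"
  have "finite D"
  proof -
    obtain C where C: "(SUP (x, y) \<in> eff_dom F \<times> eff_dom F. ereal (infnorm (x - y))) \<le> ereal C"
      using less_PInf_Ex_of_nat[THEN iffD1, OF less_imp_neq, OF assms(3)] less_imp_le that by blast
    have "\<bar>z $ i\<bar> \<le> \<bar>z0 $ i\<bar> + \<lceil>C\<rceil>" if "z \<in> D" for z i
    proof -
      have "(real_vec z, real_vec z0) \<in> eff_dom F \<times> eff_dom F"
        using that z0 by (auto simp: D_def eff_dom_def assms(2))
      then have "ereal (infnorm (real_vec z - real_vec z0)) \<le> ereal C"
        using C by (auto simp: SUP_le_iff)
      then have "\<bar>(real_vec z - real_vec z0) $ i\<bar> \<le> C"
        by (meson component_le_infnorm_cart ereal_less_eq(3) order_trans)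
      then show ?thesis by (simp add: real_vec_def) linarith
    qed
    then have "D \<subseteq> {z. \<forall>i. \<bar>z $ i\<bar> \<le> \<bar>z0 $ i\<bar> + \<lceil>C\<rceil>}" by auto
    then show ?thesis by (rule finite_subset[OF _ finite_int_vectors_bounded])
  qed
  have "z0 \<in> D" using z0 by (simp add: D_def)
  obtain y0 where y0: "y0 \<in> D" "\<And>z. z \<in> D \<Longrightarrow> f y0 \<le> f z"
    using that[of "arg_min_on f D"] arg_min_least[of D _ f] arg_min_if_finite(1)[of D f]
      \<open>finite D\<close> \<open>z0 \<in> D\<close> by blast
  have y0_min: "y0 \<in> argmin f"
    unfolding argmin_def
  proof (intro CollectI allI)
    show "f y0 \<le> f z" for z using y0(2)[of z] by (cases "z \<in> D") (auto simp: D_def)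
  qed
  have argmin_D: "argmin f \<subseteq> D"
    using z0 by (auto simp: argmin_def D_def)
  define l1 where "l1 y = (\<Sum>i\<in>UNIV. \<bar>real_of_int (y $ i) - xbar $ i\<bar>)" for y :: "int ^ 'n"
  have "finite (argmin f)" using argmin_D \<open>finite D\<close> by (rule finite_subset)
  then obtain y where y: "y \<in> argmin f" "\<And>z. z \<in> argmin f \<Longrightarrow> l1 y \<le> l1 z"
    using that[of "arg_min_on l1 (argmin f)"] y0_min arg_min_least[of "argmin f" _ l1]
      arg_min_if_finite(1)[of "argmin f" l1] by blast
  have "\<bar>real_of_int (y $ i) - xbar $ i\<bar> \<le> real CARD('n)" for i
  proof (rule ccontr)
    define S where "S = range (\<lambda>i. \<bar>real_of_int (y $ i) - xbar $ i\<bar>)"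
    assume "\<not> ?thesis"
    moreover have "card S \<le> CARD('n)" unfolding S_def by (rule card_image_le) simp
    ultimately have "real (card S) < \<bar>real_of_int (y $ i) - xbar $ i\<bar>" by linarith
    then obtain a where a: "0 \<le> a" "a < \<bar>real_of_int (y $ i) - xbar $ i\<bar>"
        "\<And>s. s \<in> S \<Longrightarrow> s \<le> a \<or> a + 1 < s"
      using exists_unit_gap[of S "\<bar>real_of_int (y $ i) - xbar $ i\<bar>"] that
      by (auto simp: S_def)
    have gap: "\<bar>real_of_int (y $ j) - xbar $ j\<bar> \<le> a
        \<or> a + 1 < \<bar>real_of_int (y $ j) - xbar $ j\<bar>" for j
      using a(3) by (auto simp: S_def)
    \<comment> \<open>Stepping back by \<open>d\<close> brings \<open>y\<close> closer to \<open>xbar\<close>: every coordinate that moves is more than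
      \<open>1\<close> away from its target.\<close>
    define d where "d = (\<chi> i. if \<bar>real_of_int (y $ i) - xbar $ i\<bar> \<le> a then 0
        else if 0 < real_of_int (y $ i) - xbar $ i then 1 else (-1 :: int))"
    have "F (real_vec y) \<noteq> \<infinity>" using y(1) argmin_D by (auto simp: D_def assms(2))
    moreover have "F xbar \<noteq> \<infinity>"
      using assms(4) z0 by (auto simp: argmin_def assms(2))
    ultimately have "f (y - d) \<le> f y"
      unfolding assms(2) d_def
      using gap a(1) assms(1,4) by (intro exchange_across_gap) auto
    then have "y - d \<in> argmin f"
      using y(1) by (auto simp: argmin_def intro: order_trans)
    moreover have "l1 (y - d) < l1 y"
      unfolding l1_def
    proof (rule sum_strict_mono_ex1)
      have le: "\<bar>real_of_int ((y - d) $ j) - xbar $ j\<bar> \<le> \<bar>real_of_int (y $ j) - xbar $ j\<bar>"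
        and less: "a < \<bar>real_of_int (y $ j) - xbar $ j\<bar> \<Longrightarrow>
          \<bar>real_of_int ((y - d) $ j) - xbar $ j\<bar> < \<bar>real_of_int (y $ j) - xbar $ j\<bar>" for j
        using gap[of j] a(1) by (auto simp: d_def)
      show "\<forall>j\<in>UNIV. \<bar>real_of_int ((y - d) $ j) - xbar $ j\<bar> \<le> \<bar>real_of_int (y $ j) - xbar $ j\<bar>"
        using le by blast
      show "\<exists>j\<in>UNIV. \<bar>real_of_int ((y - d) $ j) - xbar $ j\<bar> < \<bar>real_of_int (y $ j) - xbar $ j\<bar>"
        using less a(2) by blast
    qed simp
    ultimately show False using y(2) by force
  qed
  then have "infnorm (real_vec y - xbar) \<le> real CARD('n)"
    by (intro infnorm_le_cart) (simp add: real_vec_def)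
  then show ?thesis using y(1) by blast
qed

end
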